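(* Let $m,p\ge2$. For an $m\times p$ Cauchon diagram $C$, let $A_C=\mathbb{C}[t_{i,\alpha}\mid(i,\alpha)\in([1,m]\times[1,p])\setminus C]$ be the polynomial algebra in $mp-|C|$ indeterminates, let $G_C$ be its field of fractions, set $t_{i,\alpha}:=0$ for $(i,\alpha)\in C$, and let $M_C=(t_{i,\alpha})\in\mathcal{M}_{m,p}(G_C)$. Let $\overline{M_C}=M_C^{(m,p+1)}$ be the matrix obtained from $M_C$ at the end of the restoration algorithm, and set $$\mathcal{M}(C):=\{[I|\Lambda]\mid [I|\Lambda](\overline{M_C})=0\}.$$ Then $\mathcal{M}(C)$ is an admissible family of minors, and if $C$ and $C'$ are two distinct Cauchon diagrams, then $\mathcal{M}(C)\ne\mathcal{M}(C')$.
   Context: Notation: $[a,b]=\{a,\dots,b\}$. For $I\subseteq[1,m]$, $\Lambda\subseteq[1,p]$ with $|I|=|\Lambda|$, $[I|\Lambda]$ denotes the minor (determinant of the submatrix with rows $I$, columns $\Lambda$). A real $m\times p$ matrix is totally nonnegative (tnn) if all its minors are nonnegative. A family $\mathcal{F}$ of minors is admissible if there is a tnn matrix $M\in\mathcal{M}_{m,p}(\mathbb{R})$ such that, for every minor $[I|J]$, $[I|J](M)=0$ if and only if $[I|J]\in\mathcal{F}$. An $m\times p$ Cauchon diagram is a subset $C\subseteq[1,m]\times[1,p]$ (the black boxes) such that if $(i,\alpha)\in C$, then either $(i,\lambda)\in C$ for all $\lambda<\alpha$ or $(k,\alpha)\in C$ for all $k<i$. Restoration algorithm: let $E=([1,m]\times[1,p]\cup\{(m,p+1)\})\setminus\{(1,1)\}$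 and $E^\circ=([1,m]\times[1,p])\setminus\{(1,1)\}$, ordered lexicographically; for $r\in E^\circ$, $r^+$ is the smallest element of $E$ that is $>r$. Given $X=(x_{i,\alpha})\in\mathcal{M}_{m,p}(K)$, $K$ a field of characteristic zero, define $X^{(r)}=(x^{(r)}_{i,\alpha})$ for $r\in E$ by: $X^{(1,2)}=X$; and for $r=(j,\beta)\in E^\circ$, if $x^{(r)}_{j,\beta}=0$ then $X^{(r^+)}=X^{(r)}$, while if $x^{(r)}_{j,\beta}\ne0$ then $x^{(r^+)}_{i,\alpha}=x^{(r)}_{i,\alpha}+x^{(r)}_{i,\beta}(x^{(r)}_{j,\beta})^{-1}x^{(r)}_{j,\alpha}$ if $i<j$ and $\alpha<\beta$, and $x^{(r^+)}_{i,\alpha}=x^{(r)}_{i,\alpha}$ otherwise. Set $\overline{X}=X^{(m,p+1)}$. *)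

theory Defs
  imports
    Complex_Main
    "HOL-Library.Poly_Mapping"
    "HOL-Library.Product_Lexorder"
    "HOL-Computational_Algebra.Fraction_Field"
    "Jordan_Normal_Form.Determinant"
    "Jordan_Normal_Form.DL_Submatrix"
begin

text \<open>
  Rows and columns are indexed from 0, as in \<^typ>\<open>'a mat\<close>: the position $(i,\alpha)$ with
  $1 \le i \le m$, $1 \le \alpha \le p$ becomes \<open>(i - 1, \<alpha> - 1)\<close>. The order on positions is the
  lexicographic one of \<open>Product_Lexorder\<close>.
\<close>

definition grid :: "nat \<Rightarrow> nat \<Rightarrow> (nat \<times> nat) set" where
  "grid m p = {..<m} \<times> {..<p}"

definition cauchon_diagram :: "nat \<Rightarrow> nat \<Rightarrow> (nat \<times> nat) set \<Rightarrow> bool" where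
  "cauchon_diagram m p C \<longleftrightarrow> C \<subseteq> grid m p \<and>
     (\<forall>(i, a)\<in>C. (\<forall>l<a. (i, l) \<in> C) \<or> (\<forall>k<i. (k, a) \<in> C))"


section \<open>Minors and total nonnegativity\<close>

text \<open>
  A minor $[I|J]$ is named by the pair \<open>(I, J)\<close>. The pair of empty sets is included; its minor,
  the determinant of the empty matrix, is 1.
\<close>

definition minors :: "nat \<Rightarrow> nat \<Rightarrow> (nat set \<times> nat set) set" where
  "minors m p = {(I, J). I \<subseteq> {..<m} \<and> J \<subseteq> {..<p} \<and> card I = card J}"

definition minor :: "'a::comm_ring_1 mat \<Rightarrow> nat set \<Rightarrow> nat set \<Rightarrow> 'a" where
  "minor X I J = det (submatrix X I J)"

definition tnn :: "nat \<Rightarrow> nat \<Rightarrow> real mat \<Rightarrow> bool" where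
  "tnn m p M \<longleftrightarrow> M \<in> carrier_mat m p \<and> (\<forall>(I, J)\<in>minors m p. 0 \<le> minor M I J)"

definition admissible :: "nat \<Rightarrow> nat \<Rightarrow> (nat set \<times> nat set) set \<Rightarrow> bool" where
  "admissible m p F \<longleftrightarrow> F \<subseteq> minors m p \<and>
     (\<exists>M. tnn m p M \<and> (\<forall>(I, J)\<in>minors m p. minor M I J = 0 \<longleftrightarrow> (I, J) \<in> F))"


section \<open>The restoration algorithm\<close>

definition pos_E :: "nat \<Rightarrow> nat \<Rightarrow> (nat \<times> nat) set" where
  "pos_E m p = (grid m p \<union> {(m - 1, p)}) - {(0, 0)}"

definition pos_E0 :: "nat \<Rightarrow> nat \<Rightarrow> (nat \<times> nat) set" where
  "pos_E0 m p = grid m p - {(0, 0)}"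

definition next_pos :: "nat \<Rightarrow> nat \<Rightarrow> nat \<times> nat \<Rightarrow> nat \<times> nat" where
  "next_pos m p r = Min {s \<in> pos_E m p. r < s}"

definition restoration_step :: "nat \<times> nat \<Rightarrow> 'a::field mat \<Rightarrow> 'a mat" where
  "restoration_step = (\<lambda>(j, b) X.
     if X $$ (j, b) = 0 then X
     else mat (dim_row X) (dim_col X) (\<lambda>(i, a).
       if i < j \<and> a < b
       then X $$ (i, a) + X $$ (i, b) * inverse (X $$ (j, b)) * X $$ (j, a)
       else X $$ (i, a)))"

text \<open>
  \<open>restoration m p X r\<close> is $X^{(r)}$; the recursion along \<^const>\<open>next_pos\<close> is given by
  \<open>restoration_first\<close> and \<open>restoration_next\<close> below.
\<close>

definition restoration :: "nat \<Rightarrow> nat \<Rightarrow> 'a::field mat \<Rightarrow> nat \<times> nat \<Rightarrow> 'a mat" where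
  "restoration m p X r = fold restoration_step (sorted_list_of_set {s \<in> pos_E0 m p. s < r}) X"

definition restored :: "nat \<Rightarrow> nat \<Rightarrow> 'a::field mat \<Rightarrow> 'a mat" where
  "restored m p X = restoration m p X (m - 1, p)"

lemma finite_E0 [simp]: "finite (pos_E0 m p)"
  by (simp add: pos_E0_def grid_def)

lemma finite_E [simp]: "finite (pos_E m p)"
  by (simp add: pos_E_def grid_def)

lemma restoration_first: "restoration m p X (0, 1) = X"
proof -
  have "{s \<in> pos_E0 m p. s < (0, 1)} = {}"
    by (auto simp: pos_E0_def)
  then show ?thesis
    by (simp only: restoration_def sorted_list_of_set_empty fold_simps)
qed

lemma E0_subset_E: "pos_E0 m p \<subseteq> pos_E m p"
  by (auto simp: pos_E0_def pos_E_def)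

lemma E0_less_last:
  assumes "s \<in> pos_E0 m p"
  shows "s < (m - 1, p)"
  using assms by (auto simp: pos_E0_def grid_def)

lemma restoration_next:
  assumes r: "r \<in> pos_E0 m p"
  shows "restoration m p X (next_pos m p r) = restoration_step r (restoration m p X r)"
proof -
  let ?S = "{s \<in> pos_E m p. r < s}"
  let ?L = "{s \<in> pos_E0 m p. s < r}"
  have "(m - 1, p) \<in> pos_E m p"
    using r by (auto simp: pos_E_def pos_E0_def grid_def)
  then have ne: "?S \<noteq> {}"
    using E0_less_last[OF r] by auto
  have fin: "finite ?S" by simp
  have mem: "next_pos m p r \<in> ?S"
    unfolding next_pos_def by (rule Min_in[OF fin ne])
  then have rn: "r < next_pos m p r" by blast
  have least: "next_pos m p r \<le> s" if "s \<in> pos_E m p" "r < s" for s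
    unfolding next_pos_def by (rule Min_le[OF fin]) (use that in auto)
  have "{s \<in> pos_E0 m p. s < next_pos m p r} = insert r ?L"
  proof (rule Set.set_eqI)
    fix s
    have "s = r \<or> s < r" if "s \<in> pos_E0 m p" "s < next_pos m p r"
      using least[of s] that E0_subset_E[of m p] by (meson leD neqE subsetD)
    moreover have "s < next_pos m p r" if "s < r"
      by (rule order.strict_trans[OF that rn])
    ultimately show "s \<in> {s \<in> pos_E0 m p. s < next_pos m p r} \<longleftrightarrow> s \<in> insert r ?L"
      using mem r by blast
  qed
  moreover have "sorted_list_of_set (insert r ?L) = sorted_list_of_set ?L @ [r]"
  proof -
    define xs where "xs = sorted_list_of_set ?L"
    have xs: "set xs = ?L" "sorted xs" "distinct xs"
      unfolding xs_def by (simp_all del: less_prod_simp)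
    then have "x \<le> r \<and> x \<noteq> r" if "x \<in> set xs" for x
      using that by (auto intro: less_imp_le simp del: less_prod_simp less_eq_prod_simp)
    with xs have "sorted (xs @ [r])" "distinct (xs @ [r])"
      by (auto simp: sorted_append simp del: less_prod_simp less_eq_prod_simp)
    then have "sorted_list_of_set (set (xs @ [r])) = xs @ [r]"
      by (rule sorted_list_of_set.idem_if_sorted_distinct)
    then show ?thesis
      using xs(1) by (simp add: xs_def del: less_prod_simp sorted_list_of_set_insert)
  qed
  ultimately show ?thesis
    by (simp add: restoration_def del: less_prod_simp less_eq_prod_simp)
qed


section \<open>The generic matrix of a Cauchon diagram\<close>

text \<open>
  Since the set of indeterminates of $A_C$ depends on \<open>C\<close>, we work in the polynomial ring over the
  complex numbers in indeterminates $t_r$ for all \<open>r :: nat \<times> nat\<close>, and in its field of fractions.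
  The algebra $A_C$ and the field $G_C$ are the subring \<open>alg_A m p C\<close> and the subfield \<open>frac_G m p C\<close> of these;
  \<open>minor_restored_in_G\<close> below shows that all the minors under consideration lie in $G_C$.
\<close>

type_synonym cpoly = "((nat \<times> nat) \<Rightarrow>\<^sub>0 nat) \<Rightarrow>\<^sub>0 complex"

definition indet :: "nat \<times> nat \<Rightarrow> cpoly" where
  "indet r = Poly_Mapping.single (Poly_Mapping.single r 1) 1"

definition alg_A :: "nat \<Rightarrow> nat \<Rightarrow> (nat \<times> nat) set \<Rightarrow> cpoly set" where
  "alg_A m p C = {f. \<forall>u\<in>Poly_Mapping.keys f. Poly_Mapping.keys u \<subseteq> grid m p - C}"

definition frac_G :: "nat \<Rightarrow> nat \<Rightarrow> (nat \<times> nat) set \<Rightarrow> cpoly fract set" where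
  "frac_G m p C = {Fraction_Field.Fract f g | f g. f \<in> alg_A m p C \<and> g \<in> alg_A m p C \<and> g \<noteq> 0}"

definition generic_matrix :: "nat \<Rightarrow> nat \<Rightarrow> (nat \<times> nat) set \<Rightarrow> cpoly fract mat" where
  "generic_matrix m p C = mat m p (\<lambda>r. if r \<in> C then 0 else Fraction_Field.Fract (indet r) 1)"

definition vanishing_minors :: "nat \<Rightarrow> nat \<Rightarrow> (nat \<times> nat) set \<Rightarrow> (nat set \<times> nat set) set" where
  "vanishing_minors m p C =
     {(I, J) \<in> minors m p. minor (restored m p (generic_matrix m p C)) I J = 0}"

lemma A_0 [simp]: "0 \<in> alg_A m p C"
  by (simp add: alg_A_def)

lemma A_1 [simp]: "1 \<in> alg_A m p C"
  by (simp add: alg_A_def)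

lemma A_add: "f \<in> alg_A m p C \<Longrightarrow> g \<in> alg_A m p C \<Longrightarrow> f + g \<in> alg_A m p C"
  using Poly_Mapping.keys_add[of f g] by (auto simp: alg_A_def)

lemma A_uminus: "f \<in> alg_A m p C \<Longrightarrow> - f \<in> alg_A m p C"
  by (simp add: alg_A_def)

lemma A_mult:
  assumes "f \<in> alg_A m p C" "g \<in> alg_A m p C"
  shows "f * g \<in> alg_A m p C"
  unfolding alg_A_def
proof (safe)
  fix u i a
  assume u: "u \<in> Poly_Mapping.keys (f * g)" and r: "(i, a) \<in> Poly_Mapping.keys u"
  obtain v w where "u = v + w" "v \<in> Poly_Mapping.keys f" "w \<in> Poly_Mapping.keys g"
    using u Poly_Mapping.keys_mult[of f g] by auto
  then have "(i, a) \<in> grid m p - C"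
    using r assms Poly_Mapping.keys_add[of v w] by (fastforce simp: alg_A_def)
  then show "(i, a) \<in> grid m p" "(i, a) \<in> C \<Longrightarrow> False" by auto
qed

lemma A_const: "Poly_Mapping.single 0 c \<in> alg_A m p C"
  by (simp add: alg_A_def)

lemma A_indet: "r \<in> grid m p - C \<Longrightarrow> indet r \<in> alg_A m p C"
  by (simp add: alg_A_def indet_def)

lemma GI: "f \<in> alg_A m p C \<Longrightarrow> g \<in> alg_A m p C \<Longrightarrow> g \<noteq> 0 \<Longrightarrow> Fraction_Field.Fract f g \<in> frac_G m p C"
  by (auto simp: frac_G_def)

lemma GE:
  assumes "x \<in> frac_G m p C"
  obtains f g where "x = Fraction_Field.Fract f g" "f \<in> alg_A m p C" "g \<in> alg_A m p C" "g \<noteq> 0"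
  using assms by (auto simp: frac_G_def)

lemma G_0 [simp]: "0 \<in> frac_G m p C"
  unfolding Zero_fract_def by (rule GI) auto

lemma G_1 [simp]: "1 \<in> frac_G m p C"
  unfolding One_fract_def by (rule GI) auto

lemma G_add: "x \<in> frac_G m p C \<Longrightarrow> y \<in> frac_G m p C \<Longrightarrow> x + y \<in> frac_G m p C"
  by (elim GE) (auto intro!: GI A_add A_mult)

lemma G_uminus: "x \<in> frac_G m p C \<Longrightarrow> - x \<in> frac_G m p C"
  by (elim GE) (auto intro!: GI A_uminus)

lemma G_mult: "x \<in> frac_G m p C \<Longrightarrow> y \<in> frac_G m p C \<Longrightarrow> x * y \<in> frac_G m p C"
  by (elim GE) (auto intro!: GI A_mult)

lemma G_inverse:
  assumes "x \<in> frac_G m p C"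
  shows "inverse x \<in> frac_G m p C"
proof -
  obtain f g where x: "x = Fraction_Field.Fract f g" "f \<in> alg_A m p C" "g \<in> alg_A m p C" "g \<noteq> 0"
    using assms by (rule GE)
  show ?thesis
  proof (cases "f = 0")
    case True
    then have "x = 0" using x by (simp add: fract_collapse)
    then show ?thesis by simp
  next
    case False
    then show ?thesis using x by (auto intro: GI)
  qed
qed

lemma G_sum: "(\<And>i. i \<in> S \<Longrightarrow> h i \<in> frac_G m p C) \<Longrightarrow> sum h S \<in> frac_G m p C"
  by (induction S rule: infinite_finite_induct) (auto intro: G_add)

lemma G_prod: "(\<And>i. i \<in> S \<Longrightarrow> h i \<in> frac_G m p C) \<Longrightarrow> prod h S \<in> frac_G m p C"
  by (induction S rule: infinite_finite_induct) (auto intro: G_mult)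

definition mats_G :: "nat \<Rightarrow> nat \<Rightarrow> (nat \<times> nat) set \<Rightarrow> cpoly fract mat set" where
  "mats_G m p C = {X \<in> carrier_mat m p. \<forall>i<m. \<forall>a<p. X $$ (i, a) \<in> frac_G m p C}"

lemma generic_matrix_in_G: "generic_matrix m p C \<in> mats_G m p C"
proof -
  have "generic_matrix m p C $$ (i, a) \<in> frac_G m p C" if "i < m" "a < p" for i a
  proof (cases "(i, a) \<in> C")
    case True
    with that show ?thesis by (simp add: generic_matrix_def)
  next
    case False
    with that have "indet (i, a) \<in> alg_A m p C" by (intro A_indet) (simp add: grid_def)
    with False that show ?thesis by (simp add: generic_matrix_def GI)
  qed
  then show ?thesis by (simp add: mats_G_def generic_matrix_def)
qed

lemma restoration_step_in_G:
  assumes X: "X \<in> mats_G m p C" and r: "r \<in> pos_E0 m p"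
  shows "restoration_step r X \<in> mats_G m p C"
proof -
  obtain j b where jb: "r = (j, b)" "j < m" "b < p"
    using r by (cases r) (auto simp: pos_E0_def grid_def)
  have dims: "dim_row X = m" "dim_col X = p" using X by (auto simp: mats_G_def)
  have e: "X $$ (i, a) \<in> frac_G m p C" if "i < m" "a < p" for i a
    using X that by (simp add: mats_G_def)
  have "X $$ (i, a) + X $$ (i, b) * inverse (X $$ (j, b)) * X $$ (j, a) \<in> frac_G m p C"
    if "i < m" "a < p" for i a
    using that jb by (intro G_add G_mult G_inverse e)
  then show ?thesis
    using X e dims unfolding jb(1) restoration_step_def by (simp add: mats_G_def)
qed

lemma restoration_in_G: "restoration m p (generic_matrix m p C) r \<in> mats_G m p C"
proof -
  have "fold restoration_step rs X \<in> mats_G m p C"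
    if "set rs \<subseteq> pos_E0 m p" "X \<in> mats_G m p C" for rs X
    using that by (induction rs arbitrary: X) (auto intro: restoration_step_in_G)
  then show ?thesis
    using generic_matrix_in_G by (auto simp: restoration_def simp del: less_prod_simp)
qed

lemma det_in_G:
  assumes "\<And>i j. i < n \<Longrightarrow> j < n \<Longrightarrow> X $$ (i, j) \<in> frac_G m p C" "X \<in> carrier_mat n n"
  shows "det X \<in> frac_G m p C"
proof -
  have "signof q * (\<Prod>i = 0..<n. X $$ (i, q i)) \<in> frac_G m p C" if "q permutes {0..<n}" for q
  proof (intro G_mult G_prod)
    show "signof q \<in> frac_G m p C" by (simp add: sign_def G_uminus)
    fix i assume "i \<in> {0..<n}"
    then show "X $$ (i, q i) \<in> frac_G m p C"
      using permutes_in_image[OF that, of i] by (intro assms(1)) auto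
  qed
  then show ?thesis
    unfolding det_def'[OF assms(2)] by (intro G_sum) simp
qed

lemma minor_restored_in_G:
  assumes "(I, J) \<in> minors m p"
  shows "minor (restored m p (generic_matrix m p C)) I J \<in> frac_G m p C"
proof -
  let ?X = "restored m p (generic_matrix m p C)"
  have X: "?X \<in> mats_G m p C"
    unfolding restored_def by (rule restoration_in_G)
  then have dims: "dim_row ?X = m" "dim_col ?X = p" by (auto simp: mats_G_def)
  have I: "{i. i < m \<and> i \<in> I} = I" and J: "{j. j < p \<and> j \<in> J} = J"
    and c: "card I = card J" using assms by (auto simp: minors_def)
  have carr: "submatrix ?X I J \<in> carrier_mat (card I) (card I)"
    by (rule carrier_matI) (simp_all only: dim_submatrix dims I J c)
  show ?thesis
    unfolding minor_def
  proof (rule det_in_G[OF _ carr])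
    fix i j assume ij: "i < card I" "j < card I"
    have "pick I i \<in> I" "pick J j \<in> J"
      using ij c by (auto intro!: pick_in_set)
    then have "pick I i < m" "pick J j < p" using assms by (auto simp: minors_def)
    then show "submatrix ?X I J $$ (i, j) \<in> frac_G m p C"
      using X ij(1) ij(2)[unfolded c]
      by (subst submatrix_index) (simp_all only: dims I J mats_G_def mem_Collect_eq)
  qed
qed

end

theory Submission
  imports Defs
begin

text \<open>
  Restoring along row \<open>j\<close> adds to each column \<open>a\<close> of the rows above \<open>j\<close> a combination of later
  columns: with \<open>W\<close> for these rows before and \<open>S\<close> for them after the row has been treated,
  \<open>S\<^sub>a = W\<^sub>a + (\<Sum>b>a. W\<^sub>b (t\<^sub>j\<^sub>b)\<inverse> t\<^sub>j\<^sub>a)\<close>, where the pivots \<open>t\<^sub>j\<^sub>b\<close> are entries of the matrix one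
  started with, because row \<open>j\<close> itself only changes when rows below it are treated. So the whole
  algorithm is a recursion over rows (\<open>restored_eq_restore_rows\<close>), and both halves of the theorem are
  inductions along it.

  Admissibility. Every minor of the restored matrix is a subtraction-free expression in the nonzero
  entries of the original matrix. For one row this is seen by writing the passage from \<open>W\<close> to \<open>S\<close>,
  with row \<open>j\<close> appended, as a chain of column operations \<open>col q += s col b\<close> from right to left,
  where \<open>b\<close> is the next white box to the right of the white box \<open>q\<close> and \<open>s = t\<^sub>j\<^sub>q / t\<^sub>j\<^sub>b\<close>. In a Cauchon
  diagram a black box between \<open>q\<close> and \<open>b\<close> has only black boxes above it, so the columns strictly
  between are zero at that moment and the operation acts on minors as one between adjacent columns:
  it adds to a minor \<open>s\<close> times another minor, with sign \<open>+\<close>. Subtraction-freeness is expressed by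
  parametricity: any relation between two fields that respects \<open>0\<close>, \<open>1\<close>, sums, products and inverses
  relates the minors of restored matrices if it relates the original entries and the zeros of
  these form a Cauchon diagram (\<open>R_restore_rows\<close>). Taking the relation
  ``both zero or both positive'' between rational functions and real numbers, the restoration of
  the 0/1 matrix of the diagram is totally nonnegative and has exactly the zero minors of the
  generic matrix.

  Injectivity. From the rows of \<open>C\<close> below \<open>i\<close> one can read off, for each column \<open>a\<close>, a minor of the
  restored matrix that vanishes if and only if \<open>(i, a) \<in> C\<close> (\<open>entry_detecting_minor\<close>). It starts as
  the entry \<open>(i, a)\<close>; when the restoration treats row \<open>j\<close>, that row is adjoined together with the
  first white column to the right of the current ones, whenever the row interferes with the
  current minor. So if two diagrams have the same vanishing minors, their rows agree from the
  bottom upwards (\<open>vanishing_minors_inj\<close>).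
\<close>

section \<open>Minors with listed rows and columns\<close>

text \<open>
  Lists in place of sets of rows and columns: replacing one column in a list keeps the positions
  of the others, so column operations need no bookkeeping of signs.
\<close>

definition list_minor :: "(nat \<Rightarrow> nat \<Rightarrow> 'a::comm_ring_1) \<Rightarrow> nat list \<Rightarrow> nat list \<Rightarrow> 'a" where
  "list_minor f rs cs = det (mat (length rs) (length rs) (\<lambda>(i, j). f (rs ! i) (cs ! j)))"

lemma pick_eq_nth_sorted_list:
  assumes "finite I" "i < card I"
  shows "pick I i = sorted_list_of_set I ! i"
proof -
  let ?xs = "map (pick I) [0..<card I]"
  have "sorted_wrt (<) ?xs"
    using pick_mono_le by (auto simp: sorted_wrt_iff_nth_less)
  then have s: "sorted ?xs" "distinct ?xs"
    by (auto simp: strict_sorted_iff)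
  have "set ?xs \<subseteq> I"
    using pick_in_set_le by auto
  moreover have "card (set ?xs) = card I"
    using distinct_card[OF s(2)] by simp
  ultimately have "set ?xs = I"
    using assms(1) by (simp add: card_subset_eq)
  then have "sorted_list_of_set I = ?xs"
    using sorted_list_of_set.idem_if_sorted_distinct[OF s] by metis
  then show ?thesis
    using assms(2) by simp
qed

lemma minor_eq_list_minor:
  assumes "(I, J) \<in> minors m p"
  shows "minor (mat m p (\<lambda>(i, a). f i a)) I J =
    list_minor f (sorted_list_of_set I) (sorted_list_of_set J)"
proof -
  have I: "I \<subseteq> {..<m}" "{i. i < m \<and> i \<in> I} = I" and J: "J \<subseteq> {..<p}" "{j. j < p \<and> j \<in> J} = J"
    and c: "card I = card J" using assms by (auto simp: minors_def)
  have fin: "finite I" "finite J"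
    using I(1) J(1) finite_subset by blast+
  have in_range: "pick I i < m" "pick J i < p" if "i < card J" for i
    using that I(1) J(1) c pick_in_set_le[of i I] pick_in_set_le[of i J] by auto
  show ?thesis
    unfolding minor_def list_minor_def submatrix_def
    by (rule arg_cong[where f = det], rule eq_matI)
      (auto simp: I J c in_range fin pick_eq_nth_sorted_list[symmetric])
qed

lemma list_minor_cong:
  assumes "length cs = length rs" "\<And>x a. x \<in> set rs \<Longrightarrow> a \<in> set cs \<Longrightarrow> f x a = g x a"
  shows "list_minor f rs cs = list_minor g rs cs"
  unfolding list_minor_def
  by (rule arg_cong[where f = det], rule eq_matI) (use assms in auto)

lemma list_minor_Nil [simp]: "list_minor f [] cs = 1"
  by (simp add: list_minor_def)

lemma list_minor_expand_col:
  assumes "q < length rs"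
  shows "list_minor f rs cs = (\<Sum>i<length rs. f (rs ! i) (cs ! q) *
    cofactor (mat (length rs) (length rs) (\<lambda>(i, j). f (rs ! i) (cs ! j))) i q)"
  unfolding list_minor_def
  by (subst laplace_expansion_column[where j = q]) (use assms in auto)

lemma list_minor_zero_col:
  assumes "length cs = length rs" "a \<in> set cs" "\<And>x. x \<in> set rs \<Longrightarrow> f x a = 0"
  shows "list_minor f rs cs = 0"
proof -
  obtain q where "q < length rs" "cs ! q = a"
    using assms(1,2) by (auto simp: in_set_conv_nth)
  then show ?thesis
    using assms(3) by (subst list_minor_expand_col[of q]) auto
qed

lemma list_minor_zero_row:
  assumes "length cs = length rs" "x \<in> set rs" "\<And>a. a \<in> set cs \<Longrightarrow> f x a = 0"
  shows "list_minor f rs cs = 0"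
proof -
  obtain q where "q < length rs" "rs ! q = x"
    using assms(1,2) by (auto simp: in_set_conv_nth)
  then show ?thesis
    using assms(1,3) unfolding list_minor_def
    by (subst laplace_expansion_row[where i = q]) auto
qed

lemma list_minor_repeated_col:
  assumes "length cs = length rs" "\<not> distinct cs"
  shows "list_minor f rs cs = 0"
proof -
  obtain i j where "i < length rs" "j < length rs" "i \<noteq> j" "cs ! i = cs ! j"
    using assms by (auto simp: distinct_conv_nth)
  then show ?thesis
    unfolding list_minor_def
    by (intro det_identical_columns[of _ "length rs" i j]) (auto intro!: eq_vecI)
qed

lemma list_minor_col_op:
  assumes len: "length cs1 + Suc (length cs2) = length rs"
    and b': "b' \<notin> set cs1" "b' \<notin> set cs2"
  shows "list_minor (\<lambda>x a. if a = b' then f x b' + c * f x b else f x a) rs (cs1 @ b' # cs2) =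
    list_minor f rs (cs1 @ b' # cs2) + c * list_minor f rs (cs1 @ b # cs2)"
proof -
  let ?n = "length rs" and ?q = "length cs1"
  let ?g = "\<lambda>x a. if a = b' then f x b' + c * f x b else f x a"
  let ?M = "\<lambda>f cs. mat ?n ?n (\<lambda>(i, j). f (rs ! i) (cs ! j))"
  have q: "?q < ?n" using len by simp
  have other: "(cs1 @ b' # cs2) ! j \<noteq> b'" "(cs1 @ b' # cs2) ! j = (cs1 @ b # cs2) ! j"
    if "j < ?n" "j \<noteq> ?q" for j
    using that b' len by (auto simp: nth_append nth_Cons' in_set_conv_nth)
  have del: "mat_delete (?M ?g (cs1 @ b' # cs2)) i ?q = mat_delete (?M f (cs1 @ b' # cs2)) i ?q"
    "mat_delete (?M f (cs1 @ b # cs2)) i ?q = mat_delete (?M f (cs1 @ b' # cs2)) i ?q" for i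
    unfolding mat_delete_def by (rule eq_matI; use other in auto)+
  show ?thesis
    by (subst (1 2 3) list_minor_expand_col[OF q])
      (simp add: cofactor_def del sum_distrib_left sum.distrib[symmetric] algebra_simps)
qed

text \<open>
  The last row of the matrix is zero except for its last entry, so the cofactor has sign \<open>+\<close>.
\<close>

lemma list_minor_corner:
  assumes len: "length cs = length rs" and zero: "\<And>a. a \<in> set cs \<Longrightarrow> f x a = 0"
  shows "list_minor f (rs @ [x]) (cs @ [b]) = list_minor f rs cs * f x b"
proof -
  let ?n = "length rs"
  let ?M = "mat (Suc ?n) (Suc ?n) (\<lambda>(i, j). f ((rs @ [x]) ! i) ((cs @ [b]) ! j))"
  have "list_minor f (rs @ [x]) (cs @ [b]) = (\<Sum>j<Suc ?n. ?M $$ (?n, j) * cofactor ?M ?n j)"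
    unfolding list_minor_def by (subst laplace_expansion_row[where i = ?n]) auto
  also have "\<dots> = ?M $$ (?n, ?n) * cofactor ?M ?n ?n"
    using len zero by (simp add: nth_append)
  also have "mat_delete ?M ?n ?n = mat ?n ?n (\<lambda>(i, j). f (rs ! i) (cs ! j))"
    unfolding mat_delete_def by (rule eq_matI) (use len in \<open>auto simp: nth_append\<close>)
  then have "?M $$ (?n, ?n) * cofactor ?M ?n ?n = list_minor f rs cs * f x b"
    using len by (simp add: cofactor_def list_minor_def nth_append)
  finally show ?thesis .
qed

section \<open>The restoration algorithm as a recursion over rows\<close>

text \<open>
  \<open>restore_rows p X j\<close> is the state after the pivots in the rows above row \<open>j\<close>. The pivots of one row can be
  treated simultaneously: the pivot \<open>(j, b)\<close> changes only columns to the left of \<open>b\<close>, so that the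
  column of a later pivot is still untouched when its turn comes, and row \<open>j\<close> is still as in \<open>X\<close>.
  Zero pivots contribute nothing since \<open>inverse 0 = 0\<close>.
\<close>

fun restore_rows :: "nat \<Rightarrow> (nat \<Rightarrow> nat \<Rightarrow> 'a::field) \<Rightarrow> nat \<Rightarrow> nat \<Rightarrow> nat \<Rightarrow> 'a" where
  "restore_rows p X 0 = X" |
  "restore_rows p X (Suc j) = (\<lambda>i a. restore_rows p X j i a +
     (if i < j then \<Sum>b\<in>{a<..<p}. restore_rows p X j i b * inverse (X j b) * X j a else 0))"

lemma restore_rows_below: "j \<le> Suc i \<Longrightarrow> restore_rows p X j i = X i"
  by (induction j) auto

lemma fold_row:
  assumes "j < m" "b \<le> p"
  shows "fold restoration_step (map (Pair j) [0..<b]) (mat m p (\<lambda>(i, a). Y i a)) =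
    mat m p (\<lambda>(i, a). Y i a + (if i < j then \<Sum>c\<in>{a<..<b}. Y i c * inverse (Y j c) * Y j a else 0))"
  using assms(2)
proof (induction b)
  case 0
  then show ?case by (auto intro!: eq_matI)
next
  case (Suc b)
  have iv: "{a<..<Suc b} = (if a < b then insert b {a<..<b} else {})" for a by auto
  show ?case
    using assms(1) Suc by (auto intro!: eq_matI simp: restoration_step_def iv)
qed

lemma fold_rows:
  assumes "j \<le> m"
  shows "fold restoration_step (List.product [0..<j] [0..<p]) (mat m p (\<lambda>(i, a). X i a)) =
    mat m p (\<lambda>(i, a). restore_rows p X j i a)"
  using assms
proof (induction j)
  case 0
  then show ?case by simp
next
  case (Suc j)
  have "List.product [0..<Suc j] [0..<p] = List.product [0..<j] [0..<p] @ map (Pair j) [0..<p]"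
    by (simp add: product_concat_map)
  moreover have below: "restore_rows p X j j = X j"
    by (simp add: restore_rows_below)
  moreover note fold_row[of j m p p "restore_rows p X j", unfolded below]
  ultimately show ?case
    using Suc by (auto intro!: eq_matI simp del: upt_Suc)
qed

lemma strict_sorted_product:
  "sorted_wrt (<) (List.product [0..<m] [0..<p])"
proof (induction m)
  case 0
  then show ?case by simp
next
  case (Suc m)
  have "List.product [0..<Suc m] [0..<p] = List.product [0..<m] [0..<p] @ map (Pair m) [0..<p]"
    by (simp add: product_concat_map)
  then show ?case
    using Suc by (auto simp: sorted_wrt_append sorted_wrt_map)
qed

lemma restored_eq_restore_rows:
  assumes "m > 0" "p > 0"
  shows "restored m p (mat m p (\<lambda>(i, a). X i a)) = mat m p (\<lambda>(i, a). restore_rows p X m i a)"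
proof -
  let ?L = "List.product [0..<m] [0..<p]"
  have "[0..<m] = 0 # [1..<m]" "[0..<p] = 0 # [1..<p]"
    using assms by (simp_all add: upt_conv_Cons)
  then obtain R where R: "?L = (0, 0) # R"
    by simp
  have s: "sorted_wrt (<) R" and first: "(0, 0) \<notin> set R"
    using strict_sorted_product[of m p] unfolding R by auto
  (* The position (0, 0), which the algorithm skips, has no rows above it: a step there is void. *)
  have "{s \<in> pos_E0 m p. s < (m - 1, p)} = set ?L - {(0, 0)}"
    using E0_less_last[of _ m p] unfolding pos_E0_def grid_def by (auto simp del: less_prod_simp)
  also have "\<dots> = set R"
    using first unfolding R by auto
  finally have "sorted_list_of_set {s \<in> pos_E0 m p. s < (m - 1, p)} = R"
    using s by (metis sorted_list_of_set.idem_if_sorted_distinct strict_sorted_iff)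
  then have "restored m p (mat m p (\<lambda>(i, a). X i a)) =
      fold restoration_step ?L (mat m p (\<lambda>(i, a). X i a))"
    unfolding restored_def restoration_def R
    by (auto simp: restoration_step_def intro!: arg_cong[where f = "fold _ _"] eq_matI)
  then show ?thesis
    by (simp add: fold_rows)
qed

section \<open>Subtraction-free expressions for the minors\<close>

definition cauchon_zeros :: "nat \<Rightarrow> nat \<Rightarrow> (nat \<Rightarrow> nat \<Rightarrow> 'a::zero) \<Rightarrow> bool" where
  "cauchon_zeros m p X \<longleftrightarrow>
    (\<forall>i<m. \<forall>a<p. X i a = 0 \<longrightarrow> (\<forall>l<a. X i l = 0) \<or> (\<forall>k<i. X k a = 0))"

lemma restore_rows_zero_col:
  assumes "\<And>k. k < n \<Longrightarrow> X k a = 0" "j \<le> n" "i < n"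
  shows "restore_rows p X j i a = 0"
  using assms(2) by (induction j) (use assms(1,3) in auto)

text \<open>
  The stages of the passage, by column operations from right to left, from the rows above \<open>j\<close> to
  these rows restored along row \<open>j\<close>, with row \<open>j\<close> appended. At stage \<open>q\<close> the columns \<open>\<ge> q\<close> are in
  their final form. The extra column \<open>p\<close> is the unit vector at row \<open>j\<close>; it acts as a white box to
  the right of all others, through which row \<open>j\<close> enters, so that the initial stage \<open>q = p\<close> is a
  block matrix with blocks \<open>restore_rows p X j\<close> and \<open>1\<close>.
\<close>

definition partial_row :: "nat \<Rightarrow> (nat \<Rightarrow> nat \<Rightarrow> 'a::field) \<Rightarrow> nat \<Rightarrow> nat \<Rightarrow> nat \<Rightarrow> nat \<Rightarrow> 'a" where
  "partial_row p X j q i a =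
    (if i < j then if a = p then 0 else if a < q then restore_rows p X j i a else restore_rows p X (Suc j) i a
     else if a = p then 1 else if a < q then 0 else X j a)"

lemma partial_row_black:
  assumes "q < p" "X j q = 0"
  shows "partial_row p X j q i a = partial_row p X j (Suc q) i a"
  using assms by (auto simp: partial_row_def less_Suc_eq)

text \<open>
  With \<open>b\<close> the next white box to the right of \<open>q\<close>, or \<open>b = p\<close> if there is none, column \<open>b\<close>
  in its final form already contains the contributions of all pivots from \<open>b\<close> on, each scaled by
  \<open>X j b\<close> (by \<open>1\<close> for \<open>b = p\<close>); rescaling by \<open>X j q / X j b\<close> gives exactly what the restoration
  adds to column \<open>q\<close>.
\<close>

lemma partial_row_white:
  assumes q: "q < b" "b \<le> p" and b: "b < p \<Longrightarrow> X j b \<noteq> 0"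
    and gap: "\<And>c. q < c \<Longrightarrow> c < b \<Longrightarrow> X j c = 0"
    and s: "s = X j q * (if b < p then inverse (X j b) else 1)"
  shows "partial_row p X j q = (\<lambda>i a. if a = q
    then partial_row p X j (Suc q) i q + s * partial_row p X j (Suc q) i b
    else partial_row p X j (Suc q) i a)"
proof (intro ext)
  fix i a
  let ?t = "\<lambda>c. restore_rows p X j i c * inverse (X j c)"
  have "restore_rows p X (Suc j) i q = restore_rows p X j i q + s * partial_row p X j (Suc q) i b" if "i < j"
  proof -
    have "(\<Sum>c\<in>{q<..<p}. ?t c) = (\<Sum>c\<in>{b..<p}. ?t c)"
      by (rule sum.mono_neutral_right) (use q gap in auto)
    also have "{b..<p} = (if b < p then insert b {b<..<p} else {})"
      by auto
    also have "sum ?t \<dots> = (if b < p then ?t b + (\<Sum>c\<in>{b<..<p}. ?t c) else 0)"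
      by simp
    finally have *: "(\<Sum>c\<in>{q<..<p}. ?t c) = \<dots>" .
    have "restore_rows p X (Suc j) i q = restore_rows p X j i q + (\<Sum>c\<in>{q<..<p}. ?t c) * X j q"
      using that by (simp add: sum_distrib_right)
    also have "(\<Sum>c\<in>{q<..<p}. ?t c) * X j q = s * partial_row p X j (Suc q) i b"
      unfolding * s using that q b
      by (auto simp: partial_row_def sum_distrib_left sum_distrib_right field_simps)
    finally show ?thesis .
  qed
  then show "partial_row p X j q i a = (if a = q
    then partial_row p X j (Suc q) i q + s * partial_row p X j (Suc q) i b
    else partial_row p X j (Suc q) i a)"
    using q b s by (auto simp: partial_row_def less_Suc_eq simp del: restore_rows.simps)
qed

text \<open>
  By the defining property of a Cauchon diagram, a black box with a white box
  to its left has only black boxes above it, and a zero column of \<open>X\<close> stays zero.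
\<close>

lemma partial_row_gap:
  assumes X: "cauchon_zeros m p X" "j < m" and "X j q \<noteq> 0" "q < a" "a < p" "X j a = 0"
  shows "partial_row p X j (Suc q) i a = 0"
proof -
  have "X k a = 0" if "k < j" for k
    using assms that unfolding cauchon_zeros_def by blast
  then have "restore_rows p X j i a = 0" if "i < j"
    using that by (intro restore_rows_zero_col[of j]) auto
  then show ?thesis
    using assms by (auto simp: partial_row_def)
qed

lemma strict_sorted_last:
  fixes xs :: "nat list"
  assumes "sorted_wrt (<) xs" "set xs \<subseteq> {..n}" "n \<in> set xs"
  obtains ys where "xs = ys @ [n]" "sorted_wrt (<) ys" "set ys \<subseteq> {..<n}"
proof (cases xs rule: rev_cases)
  case Nil
  then show ?thesis using assms by auto
next
  case (snoc ys x)
  have "x = n"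
    using assms unfolding snoc by (fastforce simp: sorted_wrt_append)
  then show ?thesis
    using assms snoc by (intro that[of ys]) (auto simp: sorted_wrt_append)
qed

text \<open>
  A parametric form of ``both sides are given by the same subtraction-free expression''. The last
  axiom makes the zero patterns on both sides agree, so that the algorithm takes the same branches.
\<close>

locale subtraction_free =
  fixes R :: "'a::field \<Rightarrow> 'b::field \<Rightarrow> bool"
  assumes R_0: "R 0 0" and R_1: "R 1 1"
    and R_add: "R x y \<Longrightarrow> R x' y' \<Longrightarrow> R (x + x') (y + y')"
    and R_mult: "R x y \<Longrightarrow> R x' y' \<Longrightarrow> R (x * x') (y * y')"
    and R_inverse: "R x y \<Longrightarrow> R (inverse x) (inverse y)"
    and R_zero_iff: "R x y \<Longrightarrow> x = 0 \<longleftrightarrow> y = 0"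
begin

text \<open>
  Expanding along column \<open>b'\<close>, the new minor is the old one plus \<open>c\<close> times the minor with \<open>b'\<close>
  replaced by \<open>b\<close>. Either the replaced list is again increasing, or some chosen column lies in
  \<open>{b'<..b}\<close>, and then the second minor has a repeated or a zero column.
\<close>

lemma R_col_op:
  assumes rel: "\<And>cs. sorted_wrt (<) cs \<Longrightarrow> set cs \<subseteq> B \<Longrightarrow> length cs = length rs \<Longrightarrow>
      R (list_minor f rs cs) (list_minor g rs cs)"
    and b: "b' < b" "b \<in> B" and c: "R c d"
    and gap: "\<And>x a. x \<in> set rs \<Longrightarrow> b' < a \<Longrightarrow> a < b \<Longrightarrow> f x a = 0 \<and> g x a = 0"
    and cs: "sorted_wrt (<) cs" "set cs \<subseteq> B" "length cs = length rs"
  shows "R (list_minor (\<lambda>x a. if a = b' then f x b' + c * f x b else f x a) rs cs)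
    (list_minor (\<lambda>x a. if a = b' then g x b' + d * g x b else g x a) rs cs)"
proof (cases "b' \<in> set cs")
  case False
  then have same: "list_minor (\<lambda>x a. if a = b' then h x b' + e * h x b else h x a) rs cs =
      list_minor h rs cs" for h :: "nat \<Rightarrow> nat \<Rightarrow> 'c::field" and e
    using cs by (intro list_minor_cong) auto
  show ?thesis
    unfolding same by (rule rel[OF cs])
next
  case True
  then obtain cs1 cs2 where split: "cs = cs1 @ b' # cs2"
    by (auto dest: split_list)
  let ?cs = "cs1 @ b # cs2"
  have len: "length ?cs = length rs" "length cs1 + Suc (length cs2) = length rs"
    using cs(3) split by simp_all
  have notin: "b' \<notin> set cs1" "b' \<notin> set cs2"
    using cs(1) split by (auto simp: sorted_wrt_append)
  have "R (list_minor f rs ?cs) (list_minor g rs ?cs)"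
  proof (cases "\<exists>a\<in>set cs2. a \<le> b")
    case False
    then show ?thesis
      using cs b split by (intro rel len) (fastforce simp: sorted_wrt_append)+
  next
    case True
    then obtain a where a: "a \<in> set cs2" "b' < a" "a = b \<or> a < b"
      using cs(1) split by (auto simp: sorted_wrt_append le_less)
    have "list_minor f rs ?cs = 0 \<and> list_minor g rs ?cs = 0"
    proof (cases "a = b")
      case True
      then show ?thesis
        using a len by (simp add: list_minor_repeated_col)
    next
      case False
      then show ?thesis
        using a gap len by (auto intro!: list_minor_zero_col[of _ _ a])
    qed
    then show ?thesis
      by (simp add: R_0)
  qed
  then show ?thesis
    using rel[OF cs] c unfolding split
    by (simp add: list_minor_col_op[OF len(2) notin] R_add R_mult)
qed

context
  fixes X :: "nat \<Rightarrow> nat \<Rightarrow> 'a" and Y :: "nat \<Rightarrow> nat \<Rightarrow> 'b" and m p :: nat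
  assumes XY: "\<And>i a. i < m \<Longrightarrow> a < p \<Longrightarrow> R (X i a) (Y i a)"
    and cauchon: "cauchon_zeros m p X"
begin

lemma zero_iff: "i < m \<Longrightarrow> a < p \<Longrightarrow> X i a = 0 \<longleftrightarrow> Y i a = 0"
  using XY R_zero_iff by blast

lemma cauchon_Y: "cauchon_zeros m p Y"
  using cauchon unfolding cauchon_zeros_def
  by (metis zero_iff less_trans)

lemma R_partial_row:
  assumes IH: "\<And>rs cs. sorted_wrt (<) rs \<Longrightarrow> set rs \<subseteq> {..<j} \<Longrightarrow> sorted_wrt (<) cs \<Longrightarrow>
      set cs \<subseteq> {..<p} \<Longrightarrow> length cs = length rs \<Longrightarrow>
      R (list_minor (restore_rows p X j) rs cs) (list_minor (restore_rows p Y j) rs cs)"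
    and j: "j < m" and q: "q \<le> p"
    and rs: "sorted_wrt (<) rs" "set rs \<subseteq> {..j}"
    and cs: "sorted_wrt (<) cs" "set cs \<subseteq> {..p}" "length cs = length rs"
  shows "R (list_minor (partial_row p X j q) rs cs) (list_minor (partial_row p Y j q) rs cs)"
  using q cs
proof (induction q arbitrary: cs rule: inc_induct)
  case base
  show ?case
  proof (cases "j \<in> set rs")
    case False
    then have rs': "set rs \<subseteq> {..<j}"
      using rs(2) by (auto simp: less_le)
    show ?thesis
    proof (cases "p \<in> set cs")
      case True
      with rs' base(3) have "list_minor (partial_row p X j p) rs cs = 0"
          "list_minor (partial_row p Y j p) rs cs = 0"
        by (auto intro!: list_minor_zero_col[of _ _ p] simp: partial_row_def)
      then show ?thesis by (simp add: R_0)
    next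
      case False
      with base(2) have cs': "set cs \<subseteq> {..<p}"
        by (auto simp: less_le)
      with rs' base(3) have "list_minor (partial_row p X j p) rs cs = list_minor (restore_rows p X j) rs cs"
          "list_minor (partial_row p Y j p) rs cs = list_minor (restore_rows p Y j) rs cs"
        by (auto intro!: list_minor_cong simp: partial_row_def)
      then show ?thesis
        using IH[OF rs(1) rs' base(1) cs' base(3)] by simp
    qed
  next
    case True
    then obtain rs' where rs': "rs = rs' @ [j]" "sorted_wrt (<) rs'" "set rs' \<subseteq> {..<j}"
      using strict_sorted_last[OF rs] by blast
    show ?thesis
    proof (cases "p \<in> set cs")
      case False
      with base(2) True base(3) have "list_minor (partial_row p X j p) rs cs = 0"
          "list_minor (partial_row p Y j p) rs cs = 0"
        by (auto intro!: list_minor_zero_row[of _ _ j] simp: partial_row_def less_le)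
      then show ?thesis by (simp add: R_0)
    next
      case True
      then obtain cs' where cs': "cs = cs' @ [p]" "sorted_wrt (<) cs'" "set cs' \<subseteq> {..<p}"
        using strict_sorted_last base by blast
      have len: "length cs' = length rs'"
        using base(3) rs' cs' by simp
      have "list_minor (partial_row p X j p) rs cs = list_minor (restore_rows p X j) rs' cs'"
        "list_minor (partial_row p Y j p) rs cs = list_minor (restore_rows p Y j) rs' cs'"
        using rs' cs' len unfolding rs'(1) cs'(1)
        by (subst list_minor_corner, auto simp: partial_row_def intro!: list_minor_cong)+
      then show ?thesis
        using IH rs' cs' len by simp
    qed
  qed
next
  case (step q)
  show ?case
  proof (cases "X j q = 0")
    case True
    then have "partial_row p X j q = partial_row p X j (Suc q)"
      "partial_row p Y j q = partial_row p Y j (Suc q)"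
      using step(2) zero_iff[OF j] by (auto intro!: ext partial_row_black)
    then show ?thesis
      using step.IH step.prems by simp
  next
    case False
    define b where "b = (LEAST b. q < b \<and> (b = p \<or> X j b \<noteq> 0))"
    have "q < b \<and> (b = p \<or> X j b \<noteq> 0)"
      unfolding b_def by (rule LeastI[of _ p]) (use step in simp)
    moreover have "b \<le> p"
      unfolding b_def by (rule Least_le) (use step in simp)
    moreover have gap: "X j c = 0" if "q < c" "c < b" for c
      using not_less_Least[OF that(2)[unfolded b_def]] that(1) by auto
    ultimately have b: "q < b" "b \<le> p" "b < p \<Longrightarrow> X j b \<noteq> 0"
      by auto
    have Y: "Y j q \<noteq> 0" "b < p \<Longrightarrow> Y j b \<noteq> 0" "\<And>c. q < c \<Longrightarrow> c < b \<Longrightarrow> Y j c = 0"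
      using False b gap zero_iff[OF j] step(2) by auto
    define s where "s = X j q * (if b < p then inverse (X j b) else 1)"
    define t where "t = Y j q * (if b < p then inverse (Y j b) else 1)"
    have st: "R s t"
      unfolding s_def t_def using XY[OF j] step(2) by (auto intro!: R_mult R_inverse R_1)
    have eqs: "partial_row p X j q = (\<lambda>i a. if a = q
        then partial_row p X j (Suc q) i q + s * partial_row p X j (Suc q) i b
        else partial_row p X j (Suc q) i a)"
      "partial_row p Y j q = (\<lambda>i a. if a = q
        then partial_row p Y j (Suc q) i q + t * partial_row p Y j (Suc q) i b
        else partial_row p Y j (Suc q) i a)"
      by (rule partial_row_white; use b gap Y s_def t_def in auto)+
    show ?thesis
      unfolding eqs
    proof (rule R_col_op[where B = "{..p}"])
      show "partial_row p X j (Suc q) x a = 0 \<and> partial_row p Y j (Suc q) x a = 0"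
        if "q < a" "a < b" for x a
        using that b gap Y False j
          partial_row_gap[OF cauchon j, of q a x] partial_row_gap[OF cauchon_Y j, of q a x] by auto
    qed (use step b st in auto)
  qed
qed

lemma R_restore_rows:
  assumes "j \<le> m" "sorted_wrt (<) rs" "set rs \<subseteq> {..<j}" "sorted_wrt (<) cs"
      "set cs \<subseteq> {..<p}" "length cs = length rs"
  shows "R (list_minor (restore_rows p X j) rs cs) (list_minor (restore_rows p Y j) rs cs)"
  using assms
proof (induction j arbitrary: rs cs)
  case 0
  then show ?case by (simp add: R_1)
next
  case (Suc j)
  have eq: "partial_row p Z j 0 x a = restore_rows p Z (Suc j) x a" if "x \<le> j" "a < p"
    for Z :: "nat \<Rightarrow> nat \<Rightarrow> 'c::field" and x a
    using that by (cases "x = j") (auto simp: partial_row_def restore_rows_below)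
  have "R (list_minor (partial_row p X j 0) rs cs) (list_minor (partial_row p Y j 0) rs cs)"
    by (rule R_partial_row) (use Suc in \<open>auto simp: less_Suc_eq_le\<close>)
  moreover have "list_minor (partial_row p X j 0) rs cs = list_minor (restore_rows p X (Suc j)) rs cs"
    "list_minor (partial_row p Y j 0) rs cs = list_minor (restore_rows p Y (Suc j)) rs cs"
    by (rule list_minor_cong; use Suc.prems in \<open>force intro!: eq simp del: restore_rows.simps\<close>)+
  ultimately show ?case
    by simp
qed

end

end

section \<open>Vanishing minors and linear dependence\<close>

declare restore_rows.simps [simp del]

definition col_comb :: "(nat \<Rightarrow> 'a::comm_ring_1) \<Rightarrow> (nat \<Rightarrow> nat \<Rightarrow> 'a) \<Rightarrow> nat set \<Rightarrow> nat \<Rightarrow> 'a" where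
  "col_comb v f I c = (\<Sum>x\<in>I. v x * f x c)"

definition dependent_rows :: "(nat \<Rightarrow> nat \<Rightarrow> 'a::comm_ring_1) \<Rightarrow> nat set \<Rightarrow> nat set \<Rightarrow> bool" where
  "dependent_rows f I J \<longleftrightarrow> (\<exists>v. (\<exists>x\<in>I. v x \<noteq> 0) \<and> (\<forall>c\<in>J. col_comb v f I c = 0))"

lemma list_minor_eq_0_iff:
  fixes f :: "nat \<Rightarrow> nat \<Rightarrow> 'a::field"
  assumes len: "length cs = length rs" and rs: "distinct rs"
  shows "list_minor f rs cs = 0 \<longleftrightarrow> dependent_rows f (set rs) (set cs)"
proof -
  let ?n = "length rs"
  let ?A = "mat ?n ?n (\<lambda>(i, j). f (rs ! i) (cs ! j))"
  have bij: "bij_betw ((!) rs) {..<?n} (set rs)"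
    using rs by (rule bij_betw_nth) auto
  have comb: "col_comb w f (set rs) c = (\<Sum>i<?n. w (rs ! i) * f (rs ! i) c)" for w c
    unfolding col_comb_def by (rule sum.reindex_bij_betw[OF bij, symmetric])
  have "list_minor f rs cs = det (transpose_mat ?A)"
    unfolding list_minor_def by (subst det_transpose[of _ ?n]) auto
  also have "\<dots> = 0 \<longleftrightarrow> (\<exists>v\<in>carrier_vec ?n. v \<noteq> 0\<^sub>v ?n \<and> transpose_mat ?A *\<^sub>v v = 0\<^sub>v ?n)"
    by (subst det_0_iff_vec_prod_zero_field[of _ ?n]) auto
  also have "\<dots> \<longleftrightarrow> dependent_rows f (set rs) (set cs)"
  proof
    assume "\<exists>v\<in>carrier_vec ?n. v \<noteq> 0\<^sub>v ?n \<and> transpose_mat ?A *\<^sub>v v = 0\<^sub>v ?n"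
    then obtain v where v: "v \<in> carrier_vec ?n" "v \<noteq> 0\<^sub>v ?n" "transpose_mat ?A *\<^sub>v v = 0\<^sub>v ?n"
      by blast
    define w where "w x = v $ (inv_into {..<?n} ((!) rs) x)" for x
    have w: "w (rs ! i) = v $ i" if "i < ?n" for i
      unfolding w_def using that bij by (simp add: bij_betw_def)
    obtain i where i: "i < ?n" "v $ i \<noteq> 0"
      using v(1,2) by (metis eq_vecI carrier_vecD index_zero_vec)
    have "(\<Sum>i<?n. w (rs ! i) * f (rs ! i) (cs ! q)) = (transpose_mat ?A *\<^sub>v v) $ q" if "q < ?n" for q
      using that v(1)
      by (auto simp: scalar_prod_def atLeast0LessThan w mult.commute intro!: sum.cong)
    then have "col_comb w f (set rs) c = 0" if "c \<in> set cs" for c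
      using that v(3) len unfolding comb by (auto simp: in_set_conv_nth)
    moreover have "w (rs ! i) \<noteq> 0" "rs ! i \<in> set rs"
      using i w by simp_all
    ultimately show "dependent_rows f (set rs) (set cs)"
      unfolding dependent_rows_def by blast
  next
    assume "dependent_rows f (set rs) (set cs)"
    then obtain w x where w: "x \<in> set rs" "w x \<noteq> 0"
        "\<And>c. c \<in> set cs \<Longrightarrow> (\<Sum>i<?n. w (rs ! i) * f (rs ! i) c) = 0"
      unfolding dependent_rows_def comb by blast
    obtain i where i: "i < ?n" "x = rs ! i"
      using w(1) by (auto simp: in_set_conv_nth)
    let ?v = "vec ?n (\<lambda>i. w (rs ! i))"
    have "?v \<noteq> 0\<^sub>v ?n"
      using i w(2) by (metis index_vec index_zero_vec(1))
    moreover have "transpose_mat ?A *\<^sub>v ?v = 0\<^sub>v ?n"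
    proof (rule eq_vecI)
      fix q assume "q < dim_vec (0\<^sub>v ?n)"
      then have q: "q < ?n" by simp
      have "(transpose_mat ?A *\<^sub>v ?v) $ q = (\<Sum>i<?n. w (rs ! i) * f (rs ! i) (cs ! q))"
        using q by (auto simp: scalar_prod_def atLeast0LessThan mult.commute intro!: sum.cong)
      then show "(transpose_mat ?A *\<^sub>v ?v) $ q = 0\<^sub>v ?n $ q"
        using q w(3) len by simp
    qed simp
    ultimately show "\<exists>v\<in>carrier_vec ?n. v \<noteq> 0\<^sub>v ?n \<and> transpose_mat ?A *\<^sub>v v = 0\<^sub>v ?n"
      by (intro bexI[of _ ?v]) auto
  qed
  finally show ?thesis .
qed

section \<open>Minors that detect an entry\<close>

text \<open>
  The detecting minors are followed through the restoration via the following property. It says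
  that on the rows \<open>I\<close> each column \<open>w\<close> in the range \<open>{l..h}\<close> lies in the span of the columns
  \<open>c \<in> J\<close> with \<open>c \<ge> w\<close>, phrased dually, in terms of the combinations of rows that annihilate
  these columns.
\<close>

definition chained :: "(nat \<Rightarrow> nat \<Rightarrow> 'a::comm_ring_1) \<Rightarrow> nat set \<Rightarrow> nat set \<Rightarrow> nat \<Rightarrow> nat \<Rightarrow> bool" where
  "chained f I J l h \<longleftrightarrow> (\<forall>v w. l \<le> w \<longrightarrow> w \<le> h \<longrightarrow>
    (\<forall>c\<in>J. w \<le> c \<longrightarrow> col_comb v f I c = 0) \<longrightarrow> col_comb v f I w = 0)"

text \<open>
  Here \<open>d\<close> and \<open>u\<close> stand for a fixed linear functional applied to the columns before and after a
  unitriangular column operation inside the range \<open>{l..h}\<close>. By the span property \<open>ch\<close>, vanishing on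
  the chosen columns \<open>\<ge> w\<close> means vanishing on all of \<open>{w..h}\<close>, a condition that such an
  operation preserves.
\<close>

lemma chained_unitriangular:
  fixes d u :: "nat \<Rightarrow> 'a::comm_ring_1"
  assumes u: "\<And>a. l \<le> a \<Longrightarrow> a \<le> h \<Longrightarrow> u a = d a + (\<Sum>b\<in>{a<..h}. d b * s b a)"
    and ch: "\<And>w. l \<le> w \<Longrightarrow> w \<le> h \<Longrightarrow> \<forall>c\<in>J. w \<le> c \<longrightarrow> d c = 0 \<Longrightarrow> d w = 0"
    and J: "J \<subseteq> {l..h}" and w: "l \<le> w"
  shows "(\<forall>c\<in>J. w \<le> c \<longrightarrow> u c = 0) \<longleftrightarrow> (\<forall>a. w \<le> a \<and> a \<le> h \<longrightarrow> d a = 0)"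
    and "(\<forall>c\<in>J. w \<le> c \<longrightarrow> u c = 0) \<longleftrightarrow> (\<forall>a. w \<le> a \<and> a \<le> h \<longrightarrow> u a = 0)"
    and "(\<forall>c\<in>J. w \<le> c \<longrightarrow> d c = 0) \<longleftrightarrow> (\<forall>a. w \<le> a \<and> a \<le> h \<longrightarrow> d a = 0)"
proof -
  have 1: "d a = 0" if "\<forall>c\<in>J. w \<le> c \<longrightarrow> u c = 0" "w \<le> a" "a \<le> h" for a
    using that(2,3)
  proof (induction "h - a" arbitrary: a rule: less_induct)
    case less
    have later: "d b = 0" if "a < b" "b \<le> h" for b
      using that less.prems by (intro less.hyps) auto
    show ?case
    proof (cases "a \<in> J")
      case True
      then have "u a = 0" using \<open>\<forall>c\<in>J. w \<le> c \<longrightarrow> u c = 0\<close> less.prems by blast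
      then show ?thesis
        using u[of a] later less.prems w by simp
    next
      case False
      show ?thesis
      proof (rule ch)
        show "\<forall>c\<in>J. a \<le> c \<longrightarrow> d c = 0"
          using later False J by (metis atLeastAtMost_iff le_neq_implies_less subsetD)
      qed (use less.prems w in auto)
    qed
  qed
  have 2: "u a = 0" if "\<forall>a. w \<le> a \<and> a \<le> h \<longrightarrow> d a = 0" "w \<le> a" "a \<le> h" for a
    using that w by (subst u) (auto intro!: sum.neutral)
  have 3: "d a = 0" if "\<forall>c\<in>J. w \<le> c \<longrightarrow> d c = 0" "w \<le> a" "a \<le> h" for a
    by (rule ch) (use that w in auto)
  have le_h: "c \<le> h" if "c \<in> J" for c
    using that J by auto
  show "(\<forall>c\<in>J. w \<le> c \<longrightarrow> u c = 0) \<longleftrightarrow> (\<forall>a. w \<le> a \<and> a \<le> h \<longrightarrow> d a = 0)"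
    using 1 2 le_h by blast
  then show "(\<forall>c\<in>J. w \<le> c \<longrightarrow> u c = 0) \<longleftrightarrow> (\<forall>a. w \<le> a \<and> a \<le> h \<longrightarrow> u a = 0)"
    using 2 le_h by blast
  show "(\<forall>c\<in>J. w \<le> c \<longrightarrow> d c = 0) \<longleftrightarrow> (\<forall>a. w \<le> a \<and> a \<le> h \<longrightarrow> d a = 0)"
    using 3 le_h by blast
qed

lemma col_comb_restore_rows_Suc:
  assumes "I \<subseteq> {..<j}"
  shows "col_comb v (restore_rows p X (Suc j)) I a = col_comb v (restore_rows p X j) I a +
    (\<Sum>b\<in>{a<..<p}. col_comb v (restore_rows p X j) I b * (inverse (X j b) * X j a))"
proof -
  have "col_comb v (restore_rows p X (Suc j)) I a =
      (\<Sum>x\<in>I. v x * restore_rows p X j x a + (\<Sum>b\<in>{a<..<p}. v x * restore_rows p X j x b * (inverse (X j b) * X j a)))"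
    unfolding col_comb_def
    by (rule sum.cong) (use assms in \<open>auto simp: restore_rows.simps algebra_simps sum_distrib_left\<close>)
  also have "\<dots> = col_comb v (restore_rows p X j) I a +
    (\<Sum>x\<in>I. \<Sum>b\<in>{a<..<p}. v x * restore_rows p X j x b * (inverse (X j b) * X j a))"
    by (simp add: sum.distrib col_comb_def)
  also have "(\<Sum>x\<in>I. \<Sum>b\<in>{a<..<p}. v x * restore_rows p X j x b * (inverse (X j b) * X j a)) =
    (\<Sum>b\<in>{a<..<p}. col_comb v (restore_rows p X j) I b * (inverse (X j b) * X j a))"
    by (subst sum.swap) (simp add: col_comb_def sum_distrib_right)
  finally show ?thesis .
qed

text \<open>
  Under the hypothesis \<open>black\<close>, what row \<open>j\<close> adds to the columns \<open>{l..h}\<close> comes from pivots inside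
  this range only.
\<close>

lemma chained_keep:
  fixes X :: "nat \<Rightarrow> nat \<Rightarrow> 'a::field"
  assumes I: "I \<subseteq> {..<j}" and J: "J \<subseteq> {l..h}" and h: "h < p"
    and ch: "chained (restore_rows p X j) I J l h"
    and black: "(\<forall>c. l \<le> c \<and> c \<le> h \<longrightarrow> X j c = 0) \<or> (\<forall>c. h < c \<and> c < p \<longrightarrow> X j c = 0)"
  shows "chained (restore_rows p X (Suc j)) I J l h"
    and "dependent_rows (restore_rows p X (Suc j)) I J \<longleftrightarrow> dependent_rows (restore_rows p X j) I J"
proof -
  let ?d = "\<lambda>v. col_comb v (restore_rows p X j) I" and ?u = "\<lambda>v. col_comb v (restore_rows p X (Suc j)) I"
  have u: "?u v a = ?d v a + (\<Sum>b\<in>{a<..h}. ?d v b * (inverse (X j b) * X j a))"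
    if "l \<le> a" "a \<le> h" for v a
    unfolding col_comb_restore_rows_Suc[OF I] using black that h
    by (intro arg_cong[where f = "(+) _"] sum.mono_neutral_right) auto
  have chd: "?d v w = 0" if "l \<le> w" "w \<le> h" "\<forall>c\<in>J. w \<le> c \<longrightarrow> ?d v c = 0" for v w
    using ch that unfolding chained_def by blast
  have *: "(\<forall>c\<in>J. w \<le> c \<longrightarrow> ?u v c = 0) \<longleftrightarrow> (\<forall>a. w \<le> a \<and> a \<le> h \<longrightarrow> ?u v a = 0)"
    "(\<forall>c\<in>J. w \<le> c \<longrightarrow> ?u v c = 0) \<longleftrightarrow> (\<forall>c\<in>J. w \<le> c \<longrightarrow> ?d v c = 0)" if "l \<le> w" for v w
  proof -
    note tri = chained_unitriangular[where d = "?d v" and u = "?u v" and J = J and l = l and h = h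
        and w = w and s = "\<lambda>b a. inverse (X j b) * X j a"]
    show "(\<forall>c\<in>J. w \<le> c \<longrightarrow> ?u v c = 0) \<longleftrightarrow> (\<forall>a. w \<le> a \<and> a \<le> h \<longrightarrow> ?u v a = 0)"
      by (rule tri(2)) (fact u chd J that)+
    show "(\<forall>c\<in>J. w \<le> c \<longrightarrow> ?u v c = 0) \<longleftrightarrow> (\<forall>c\<in>J. w \<le> c \<longrightarrow> ?d v c = 0)"
      by (rule trans[OF tri(1) tri(3)[symmetric]]) (fact u chd J that)+
  qed
  show "chained (restore_rows p X (Suc j)) I J l h"
    unfolding chained_def using *(1) by blast
  have "(\<forall>c\<in>J. ?u v c = 0) \<longleftrightarrow> (\<forall>c\<in>J. ?d v c = 0)" for v
    using *(2)[of l v] J by auto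
  then show "dependent_rows (restore_rows p X (Suc j)) I J \<longleftrightarrow> dependent_rows (restore_rows p X j) I J"
    unfolding dependent_rows_def by simp
qed

text \<open>
  If row \<open>j\<close> has pivots to the right of \<open>h\<close>, all their contributions to a column \<open>a \<in> {l..h}\<close>
  together are \<open>X j a / X j b\<close> times the restored column \<open>b\<close>, where \<open>b\<close> is the first of them; with
  row \<open>j\<close> appended the column \<open>a\<close> also receives its entry \<open>X j a\<close> as this multiple of column \<open>b\<close>.
  Adjoining column \<open>b\<close> to the minor therefore removes all these contributions, and the entry
  \<open>X j b \<noteq> 0\<close> pays for the new row. The white box \<open>a0\<close> is what forces the columns strictly between
  \<open>h\<close> and \<open>b\<close> to vanish, so that the span property extends to \<open>{l..b}\<close>.
\<close>

lemma chained_extend: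
  fixes X :: "nat \<Rightarrow> nat \<Rightarrow> 'a::field"
  assumes X: "cauchon_zeros m p X" "j < m"
    and I: "I \<subseteq> {..<j}" and J: "J \<subseteq> {l..h}" and h: "h < b" "b < p"
    and ch: "chained (restore_rows p X j) I J l h"
    and white: "l \<le> a0" "a0 \<le> h" "X j a0 \<noteq> 0" "X j b \<noteq> 0"
    and gap: "\<And>c. h < c \<Longrightarrow> c < b \<Longrightarrow> X j c = 0"
  shows "chained (restore_rows p X (Suc j)) (insert j I) (insert b J) l b"
    and "dependent_rows (restore_rows p X (Suc j)) (insert j I) (insert b J) \<longleftrightarrow>
      dependent_rows (restore_rows p X j) I J"
proof -
  let ?d = "\<lambda>v. col_comb v (restore_rows p X j) I"
  let ?S = "\<lambda>v. col_comb v (restore_rows p X (Suc j)) I"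
  let ?e = "\<lambda>v. col_comb v (restore_rows p X (Suc j)) (insert j I)"
  define u where "u v a = ?d v a + (\<Sum>b\<in>{a<..h}. ?d v b * (inverse (X j b) * X j a))" for v a
  have finI: "finite I" and jI: "j \<notin> I"
    using I finite_subset by auto
  have row_j: "restore_rows p X (Suc j) j a = X j a" for a
    by (simp add: restore_rows_below)
  have e: "?e v a = ?S v a + v j * X j a" for v a
    using finI jI row_j by (simp add: col_comb_def)
  have e_b: "?e v a = u v a + X j a * inverse (X j b) * ?e v b" if "l \<le> a" "a \<le> h" for v a
  proof -
    let ?t = "\<lambda>b. ?d v b * inverse (X j b)"
    have "{a<..<p} = {a<..h} \<union> {h<..<b} \<union> insert b {b<..<p}"
      using that h by auto
    then have "(\<Sum>c\<in>{a<..<p}. ?t c) = (\<Sum>c\<in>{a<..h}. ?t c) + (\<Sum>c\<in>{h<..<b}. ?t c) +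
        (?t b + (\<Sum>c\<in>{b<..<p}. ?t c))"
      using h by (simp add: sum.union_disjoint ivl_disj_int Int_Un_distrib2 disjoint_iff)
    moreover have "(\<Sum>c\<in>{h<..<b}. ?t c) = 0"
      using gap by (intro sum.neutral) auto
    ultimately have split: "(\<Sum>c\<in>{a<..<p}. ?t c) =
        (\<Sum>c\<in>{a<..h}. ?t c) + (?t b + (\<Sum>c\<in>{b<..<p}. ?t c))"
      by simp
    have S: "?S v c = ?d v c + (\<Sum>b\<in>{c<..<p}. ?t b) * X j c" for c
      unfolding col_comb_restore_rows_Suc[OF I] by (simp add: sum_distrib_right mult.assoc)
    have u: "u v a = ?d v a + (\<Sum>b\<in>{a<..h}. ?t b) * X j a"
      unfolding u_def by (simp add: sum_distrib_right mult.assoc)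
    show ?thesis
      unfolding e S u split using white(4) by (simp add: field_simps)
  qed
  have e_gap: "?e v a = 0" if "h < a" "a < b" for v a
  proof -
    have 0: "X j a = 0"
      using gap that by blast
    have "X k a = 0" if "k < j" for k
      using X white 0 that \<open>h < a\<close> \<open>a < b\<close> h unfolding cauchon_zeros_def
      by (meson le_less_trans less_trans)
    with 0 have "X k a = 0" if "k < Suc j" for k
      using that less_Suc_eq by auto
    then show ?thesis
      unfolding col_comb_def using I
      by (intro sum.neutral ballI) (subst restore_rows_zero_col[of "Suc j"], auto)
  qed
  have u: "u v a = ?d v a + (\<Sum>b\<in>{a<..h}. ?d v b * (inverse (X j b) * X j a))" for v a
    by (rule u_def)
  have chd: "?d v w = 0" if "l \<le> w" "w \<le> h" "\<forall>c\<in>J. w \<le> c \<longrightarrow> ?d v c = 0" for v w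
    using ch that unfolding chained_def by blast
  have *: "(\<forall>c\<in>J. w \<le> c \<longrightarrow> u v c = 0) \<longleftrightarrow> (\<forall>a. w \<le> a \<and> a \<le> h \<longrightarrow> u v a = 0)"
    "(\<forall>c\<in>J. w \<le> c \<longrightarrow> u v c = 0) \<longleftrightarrow> (\<forall>c\<in>J. w \<le> c \<longrightarrow> ?d v c = 0)" if "l \<le> w" for v w
  proof -
    note tri = chained_unitriangular[where d = "?d v" and u = "u v" and J = J and l = l and h = h
        and w = w and s = "\<lambda>b a. inverse (X j b) * X j a"]
    show "(\<forall>c\<in>J. w \<le> c \<longrightarrow> u v c = 0) \<longleftrightarrow> (\<forall>a. w \<le> a \<and> a \<le> h \<longrightarrow> u v a = 0)"
      by (rule tri(2)) (fact chd J that | rule u)+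
    show "(\<forall>c\<in>J. w \<le> c \<longrightarrow> u v c = 0) \<longleftrightarrow> (\<forall>c\<in>J. w \<le> c \<longrightarrow> ?d v c = 0)"
      by (rule trans[OF tri(1) tri(3)[symmetric]]) (fact chd J that | rule u)+
  qed
  have e_iff: "?e v c = 0 \<longleftrightarrow> u v c = 0" if "?e v b = 0" "c \<in> J" for v c
    using e_b[of c v] that J by auto
  show "chained (restore_rows p X (Suc j)) (insert j I) (insert b J) l b"
    unfolding chained_def
  proof (intro allI impI)
    fix v w assume w: "l \<le> w" "w \<le> b" and z: "\<forall>c\<in>insert b J. w \<le> c \<longrightarrow> ?e v c = 0"
    then have b0: "?e v b = 0" by blast
    with z e_iff have "\<forall>c\<in>J. w \<le> c \<longrightarrow> u v c = 0" by blast
    then have "u v w = 0" if "w \<le> h"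
      using *(1) w that by blast
    then show "?e v w = 0"
      using e_b[of w v] b0 e_gap[of w v] w by (cases "w \<le> h"; cases "w = b") auto
  qed
  show "dependent_rows (restore_rows p X (Suc j)) (insert j I) (insert b J) \<longleftrightarrow> dependent_rows (restore_rows p X j) I J"
  proof
    assume "dependent_rows (restore_rows p X (Suc j)) (insert j I) (insert b J)"
    then obtain v x where v: "x \<in> insert j I" "v x \<noteq> 0" "\<forall>c\<in>insert b J. ?e v c = 0"
      unfolding dependent_rows_def by blast
    then have "\<forall>c\<in>J. u v c = 0"
      using e_iff by blast
    then have "\<forall>c\<in>J. ?d v c = 0"
      using *(2)[of l v] J by auto
    moreover have "\<exists>x\<in>I. v x \<noteq> 0"
    proof (rule ccontr)
      assume none: "\<not> (\<exists>x\<in>I. v x \<noteq> 0)"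
      then have "?S v b = 0"
        by (simp add: col_comb_def)
      then have "v j = 0"
        using v(3) e[of v b] white(4) by simp
      then show False
        using none v(1,2) by auto
    qed
    ultimately show "dependent_rows (restore_rows p X j) I J"
      unfolding dependent_rows_def by blast
  next
    assume "dependent_rows (restore_rows p X j) I J"
    then obtain v x where v: "x \<in> I" "v x \<noteq> 0" "\<forall>c\<in>J. ?d v c = 0"
      unfolding dependent_rows_def by blast
    (* The coefficient of row j is chosen so that the combination annihilates column b. *)
    define v' where "v' = v(j := - ?S v b * inverse (X j b))"
    have same: "col_comb v' f I c = col_comb v f I c" for f c
      unfolding col_comb_def v'_def using jI by (intro sum.cong) auto
    have b0: "?e v' b = 0"
      unfolding e same using white(4) by (simp add: v'_def)
    have "\<forall>c\<in>J. u v' c = 0"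
      using *(2)[of l v'] v(3) J unfolding same by auto
    with b0 have "\<forall>c\<in>insert b J. ?e v' c = 0"
      using e_iff by blast
    moreover have "v' x \<noteq> 0"
      using v jI by (auto simp: v'_def)
    ultimately show "dependent_rows (restore_rows p X (Suc j)) (insert j I) (insert b J)"
      unfolding dependent_rows_def using v(1) by blast
  qed
qed

text \<open>
  The order of the quantifiers matters: \<open>I\<close> and \<open>J\<close> depend on the zero pattern \<open>Z\<close> of the rows below
  \<open>i\<close> only, and the same minor then serves all matrices \<open>X\<close> with this pattern.
\<close>

lemma chained_minor_exists:
  fixes Z :: "nat \<Rightarrow> nat \<Rightarrow> bool"
  assumes "Suc i \<le> j" "j \<le> m" "a < p"
  shows "\<exists>I J h. I \<subseteq> {..<j} \<and> card I = card J \<and> J \<subseteq> {a..h} \<and> h < p \<and>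
    (\<forall>X :: nat \<Rightarrow> nat \<Rightarrow> 'a::field. cauchon_zeros m p X \<longrightarrow>
      (\<forall>k c. i < k \<longrightarrow> k < j \<longrightarrow> c < p \<longrightarrow> (X k c = 0 \<longleftrightarrow> Z k c)) \<longrightarrow>
      chained (restore_rows p X j) I J a h \<and> (dependent_rows (restore_rows p X j) I J \<longleftrightarrow> X i a = 0))"
  using assms(1,2)
proof (induction j rule: dec_induct)
  case base
  have row: "restore_rows p X (Suc i) i a = X i a" for X :: "nat \<Rightarrow> nat \<Rightarrow> 'a"
    by (simp add: restore_rows_below)
  have "dependent_rows (restore_rows p X (Suc i)) {i} {a} \<longleftrightarrow> X i a = 0" for X :: "nat \<Rightarrow> nat \<Rightarrow> 'a"
    unfolding dependent_rows_def col_comb_def using row[of X]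
    by (auto intro: exI[of _ "\<lambda>_. 1"])
  moreover have "chained f {i} {a} a a" for f :: "nat \<Rightarrow> nat \<Rightarrow> 'a"
    unfolding chained_def by (metis le_antisym order_refl singletonI)
  ultimately show ?case
    using assms(3) by (intro exI[of _ "{i}"] exI[of _ "{a}"] exI[of _ a]) simp
next
  case (step j)
  then have "j \<le> m" by simp
  from step.IH[OF this] obtain I J h
    where IJ: "I \<subseteq> {..<j}" "card I = card J" "J \<subseteq> {a..h}" "h < p"
    and ch: "\<forall>X :: nat \<Rightarrow> nat \<Rightarrow> 'a. cauchon_zeros m p X \<longrightarrow>
      (\<forall>k c. i < k \<longrightarrow> k < j \<longrightarrow> c < p \<longrightarrow> (X k c = 0 \<longleftrightarrow> Z k c)) \<longrightarrow>
      chained (restore_rows p X j) I J a h \<and> (dependent_rows (restore_rows p X j) I J \<longleftrightarrow> X i a = 0)"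
    by blast
  show ?case
  proof (cases "(\<exists>c. a \<le> c \<and> c \<le> h \<and> \<not> Z j c) \<and> (\<exists>b. h < b \<and> b < p \<and> \<not> Z j b)")
    case False
    have "chained (restore_rows p X (Suc j)) I J a h \<and> (dependent_rows (restore_rows p X (Suc j)) I J \<longleftrightarrow> X i a = 0)"
      if X: "cauchon_zeros m p X" and Z: "\<And>k c. i < k \<Longrightarrow> k < Suc j \<Longrightarrow> c < p \<Longrightarrow> (X k c = 0 \<longleftrightarrow> Z k c)"
      for X :: "nat \<Rightarrow> nat \<Rightarrow> 'a"
    proof -
      have c: "chained (restore_rows p X j) I J a h" "dependent_rows (restore_rows p X j) I J \<longleftrightarrow> X i a = 0"
        using ch X Z by simp_all
      have "X j c = 0 \<longleftrightarrow> Z j c" if "c < p" for c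
        using Z step(1) that by simp
      then have "(\<forall>c. a \<le> c \<and> c \<le> h \<longrightarrow> X j c = 0) \<or> (\<forall>c. h < c \<and> c < p \<longrightarrow> X j c = 0)"
        using False IJ(4) by (meson le_less_trans)
      from chained_keep[OF IJ(1,3,4) c(1) this] c(2) show ?thesis
        by blast
    qed
    then show ?thesis
      using IJ by (intro exI[of _ I] exI[of _ J] exI[of _ h]) auto
  next
    case True
    define b where "b = (LEAST b. h < b \<and> b < p \<and> \<not> Z j b)"
    have b: "h < b" "b < p" "\<not> Z j b"
      using LeastI_ex[OF conjunct2[OF True]] unfolding b_def by auto
    have gap: "Z j c" if "h < c" "c < b" for c
      using not_less_Least[OF that(2)[unfolded b_def]] that b(2) by auto
    obtain a0 where a0: "a \<le> a0" "a0 \<le> h" "\<not> Z j a0"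
      using True by blast
    have "chained (restore_rows p X (Suc j)) (insert j I) (insert b J) a b \<and>
        (dependent_rows (restore_rows p X (Suc j)) (insert j I) (insert b J) \<longleftrightarrow> X i a = 0)"
      if X: "cauchon_zeros m p X" and Z: "\<And>k c. i < k \<Longrightarrow> k < Suc j \<Longrightarrow> c < p \<Longrightarrow> (X k c = 0 \<longleftrightarrow> Z k c)"
      for X :: "nat \<Rightarrow> nat \<Rightarrow> 'a"
    proof -
      have c: "chained (restore_rows p X j) I J a h" "dependent_rows (restore_rows p X j) I J \<longleftrightarrow> X i a = 0"
        using ch X Z by simp_all
      have row: "X j c = 0 \<longleftrightarrow> Z j c" if "c < p" for c
        using Z step(1) that by simp
      have "X j a0 \<noteq> 0" "X j b \<noteq> 0" "\<And>c. h < c \<Longrightarrow> c < b \<Longrightarrow> X j c = 0"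
        using row a0 b gap IJ(4) by auto
      from chained_extend[OF X _ IJ(1,3) b(1,2) c(1) a0(1,2) this] c(2) step.prems show ?thesis
        by simp
    qed
    moreover have "card (insert j I) = card (insert b J)"
    proof -
      have "finite I" "finite J" "j \<notin> I" "b \<notin> J"
        using IJ b finite_subset[OF IJ(1)] finite_subset[OF IJ(3)] by auto
      then show ?thesis
        using IJ(2) by simp
    qed
    moreover have "insert j I \<subseteq> {..<Suc j}" "insert b J \<subseteq> {a..b}"
      using IJ b a0 by auto
    ultimately show ?thesis
      using b(2) by blast
  qed
qed

lemma restored_minor_eq_list_minor:
  assumes "(I, J) \<in> minors m p" "m > 0" "p > 0"
  shows "minor (restored m p (mat m p (\<lambda>(i, a). X i a))) I J =
    list_minor (restore_rows p X m) (sorted_list_of_set I) (sorted_list_of_set J)"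
  using assms by (simp only: restored_eq_restore_rows minor_eq_list_minor)

lemma minorsD:
  assumes "(I, J) \<in> minors m p"
  shows "finite I" "finite J" "I \<subseteq> {..<m}" "J \<subseteq> {..<p}" "card I = card J"
  using assms unfolding minors_def by (auto intro: finite_subset)

lemma entry_detecting_minor:
  fixes Z :: "nat \<Rightarrow> nat \<Rightarrow> bool"
  assumes "i < m" "a < p"
  shows "\<exists>I J. (I, J) \<in> minors m p \<and>
    (\<forall>X :: nat \<Rightarrow> nat \<Rightarrow> 'a::field. cauchon_zeros m p X \<longrightarrow>
      (\<forall>k c. i < k \<longrightarrow> k < m \<longrightarrow> c < p \<longrightarrow> (X k c = 0 \<longleftrightarrow> Z k c)) \<longrightarrow>
      (minor (restored m p (mat m p (\<lambda>(i, a). X i a))) I J = 0 \<longleftrightarrow> X i a = 0))"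
proof -
  have "Suc i \<le> m"
    using assms by simp
  from chained_minor_exists[where 'a = 'a, OF this order_refl assms(2), of Z] obtain I J h
    where IJ: "I \<subseteq> {..<m}" "card I = card J" "J \<subseteq> {a..h}" "h < p"
    and dep: "\<forall>X :: nat \<Rightarrow> nat \<Rightarrow> 'a. cauchon_zeros m p X \<longrightarrow>
      (\<forall>k c. i < k \<longrightarrow> k < m \<longrightarrow> c < p \<longrightarrow> (X k c = 0 \<longleftrightarrow> Z k c)) \<longrightarrow>
      chained (restore_rows p X m) I J a h \<and> (dependent_rows (restore_rows p X m) I J \<longleftrightarrow> X i a = 0)"
    by blast
  have M: "(I, J) \<in> minors m p"
    using IJ by (auto simp: minors_def)
  note fin = minorsD[OF M]
  have "minor (restored m p (mat m p (\<lambda>(i, a). X i a))) I J = 0 \<longleftrightarrow> dependent_rows (restore_rows p X m) I J"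
    for X :: "nat \<Rightarrow> nat \<Rightarrow> 'a"
    using fin assms by (subst restored_minor_eq_list_minor[OF M]) (auto simp: list_minor_eq_0_iff)
  then show ?thesis
    using dep M by blast
qed

section \<open>Positivity in the field of rational functions\<close>

definition nonneg_coeffs :: "cpoly \<Rightarrow> bool" where
  "nonneg_coeffs f \<longleftrightarrow> (\<forall>u. 0 \<le> Re (Poly_Mapping.lookup f u) \<and> Im (Poly_Mapping.lookup f u) = 0)"

lemma nonneg_coeffs_mult:
  assumes "nonneg_coeffs f" "nonneg_coeffs g"
  shows "nonneg_coeffs (f * g)"
proof -
  have nonneg_Sum_any: "0 \<le> Re (Sum_any c) \<and> Im (Sum_any c) = 0"
    if "\<And>x. 0 \<le> Re (c x) \<and> Im (c x) = 0" for c :: "'x \<Rightarrow> complex"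
    unfolding Sum_any.expand_set using that by (simp add: sum_nonneg)
  have "0 \<le> Re (\<Sum>q. Poly_Mapping.lookup g q when u = l + q) \<and>
      Im (\<Sum>q. Poly_Mapping.lookup g q when u = l + q) = 0" for u l
    by (rule nonneg_Sum_any) (use assms in \<open>auto simp: nonneg_coeffs_def when_def\<close>)
  then show ?thesis
    using assms unfolding nonneg_coeffs_def lookup_mult
    by (intro allI nonneg_Sum_any) auto
qed

text \<open>
  There is no cancellation: at an exponent where \<open>f\<close> has a positive coefficient, so has \<open>f + g\<close>.
\<close>

lemma nonneg_coeffs_add:
  assumes f: "nonneg_coeffs f" "f \<noteq> 0" and g: "nonneg_coeffs g"
  shows "nonneg_coeffs (f + g)" "f + g \<noteq> 0"
proof -
  show "nonneg_coeffs (f + g)"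
    using assms by (simp add: nonneg_coeffs_def lookup_add)
  obtain u where "Poly_Mapping.lookup f u \<noteq> 0"
    using f(2) by (metis lookup_zero poly_mapping_eqI)
  then have "Re (Poly_Mapping.lookup f u) > 0"
    using f(1) by (metis complex_eq_0 nonneg_coeffs_def power2_eq_iff_nonneg sum_power2_eq_zero_iff less_le)
  then have "Re (Poly_Mapping.lookup (f + g) u) > 0"
    using g by (simp add: lookup_add nonneg_coeffs_def add_pos_nonneg)
  then show "f + g \<noteq> 0"
    by auto
qed

definition positive_fractions :: "cpoly fract set" where
  "positive_fractions = {Fraction_Field.Fract f g | f g.
    nonneg_coeffs f \<and> f \<noteq> 0 \<and> nonneg_coeffs g \<and> g \<noteq> 0}"

definition same_sign :: "cpoly fract \<Rightarrow> real \<Rightarrow> bool" where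
  "same_sign x y \<longleftrightarrow> (x = 0 \<and> y = 0) \<or> (x \<in> positive_fractions \<and> y > 0)"

lemma positive_fractionsE:
  assumes "x \<in> positive_fractions"
  obtains f g where "x = Fraction_Field.Fract f g" "nonneg_coeffs f" "f \<noteq> 0" "nonneg_coeffs g" "g \<noteq> 0"
  using assms unfolding positive_fractions_def by blast

lemma positive_fractionsI:
  "nonneg_coeffs f \<Longrightarrow> f \<noteq> 0 \<Longrightarrow> nonneg_coeffs g \<Longrightarrow> g \<noteq> 0 \<Longrightarrow>
    Fraction_Field.Fract f g \<in> positive_fractions"
  unfolding positive_fractions_def by blast

lemma nonneg_coeffs_1: "nonneg_coeffs 1"
  by (simp add: nonneg_coeffs_def lookup_one when_def)

lemma positive_fractions_closed:
  assumes "x \<in> positive_fractions" "y \<in> positive_fractions"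
  shows "x + y \<in> positive_fractions" "x * y \<in> positive_fractions"
    "inverse x \<in> positive_fractions"
proof -
  obtain f g where x: "x = Fraction_Field.Fract f g" "nonneg_coeffs f" "f \<noteq> 0" "nonneg_coeffs g" "g \<noteq> 0"
    using assms(1) by (rule positive_fractionsE)
  obtain f' g' where y: "y = Fraction_Field.Fract f' g'" "nonneg_coeffs f'" "f' \<noteq> 0" "nonneg_coeffs g'" "g' \<noteq> 0"
    using assms(2) by (rule positive_fractionsE)
  have "nonneg_coeffs (f * g' + f' * g)" "f * g' + f' * g \<noteq> 0"
    by (rule nonneg_coeffs_add; use x y in \<open>simp add: nonneg_coeffs_mult\<close>)+
  with x y show "x + y \<in> positive_fractions"
    by (simp add: positive_fractionsI nonneg_coeffs_mult)
  from x y show "x * y \<in> positive_fractions"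
    by (simp add: positive_fractionsI nonneg_coeffs_mult)
  from x show "inverse x \<in> positive_fractions"
    by (simp add: positive_fractionsI)
qed

lemma zero_notin_positive_fractions: "0 \<notin> positive_fractions"
  by (auto elim!: positive_fractionsE simp: eq_fract Zero_fract_def)

interpretation same_sign: subtraction_free same_sign
proof
  have "1 \<in> positive_fractions"
    unfolding One_fract_def by (intro positive_fractionsI nonneg_coeffs_1) auto
  then show "same_sign 1 1" by (simp add: same_sign_def)
qed (auto simp: same_sign_def positive_fractions_closed zero_notin_positive_fractions add_pos_pos)

lemma indet_nonzero: "indet r \<noteq> 0"
  unfolding indet_def by (metis lookup_single_eq lookup_zero one_neq_zero)

lemma indet_positive: "Fraction_Field.Fract (indet r) 1 \<in> positive_fractions"
  by (intro positive_fractionsI nonneg_coeffs_1 indet_nonzero)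
    (auto simp: nonneg_coeffs_def indet_def lookup_single when_def)

section \<open>The vanishing minors of a Cauchon diagram\<close>

definition generic_entry :: "(nat \<times> nat) set \<Rightarrow> nat \<Rightarrow> nat \<Rightarrow> cpoly fract" where
  "generic_entry C i a = (if (i, a) \<in> C then 0 else Fraction_Field.Fract (indet (i, a)) 1)"

lemma generic_entry_eq_0_iff: "generic_entry C i a = 0 \<longleftrightarrow> (i, a) \<in> C"
  using indet_positive[of "(i, a)"] zero_notin_positive_fractions by (auto simp: generic_entry_def)

lemma generic_matrix_eq: "generic_matrix m p C = mat m p (\<lambda>(i, a). generic_entry C i a)"
  unfolding generic_matrix_def generic_entry_def by (rule eq_matI) auto

lemma cauchon_generic_entry:
  assumes "cauchon_diagram m p C"
  shows "cauchon_zeros m p (generic_entry C)"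
  using assms unfolding cauchon_diagram_def cauchon_zeros_def generic_entry_eq_0_iff by blast

lemma admissible_vanishing_minors:
  assumes C: "cauchon_diagram m p C" and pos: "m > 0" "p > 0"
  shows "admissible m p (vanishing_minors m p C)"
proof -
  define Y :: "nat \<Rightarrow> nat \<Rightarrow> real" where "Y i a = (if (i, a) \<in> C then 0 else 1)" for i a
  let ?M = "restored m p (mat m p (\<lambda>(i, a). Y i a))"
  have sign: "same_sign (minor (restored m p (generic_matrix m p C)) I J) (minor ?M I J)"
    if M: "(I, J) \<in> minors m p" for I J
  proof -
    have "same_sign (generic_entry C i a) (Y i a)" for i a
      using indet_positive by (auto simp: same_sign_def generic_entry_def Y_def)
    then show ?thesis
      unfolding generic_matrix_eq restored_minor_eq_list_minor[OF M pos]
      using minorsD[OF M]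
      by (intro same_sign.R_restore_rows[where m = m] cauchon_generic_entry C) auto
  qed
  have "tnn m p ?M"
    unfolding tnn_def
  proof
    show "?M \<in> carrier_mat m p"
      using pos by (simp add: restored_eq_restore_rows)
    show "\<forall>(I, J)\<in>minors m p. 0 \<le> minor ?M I J"
      using sign unfolding same_sign_def by (auto simp: le_less)
  qed
  moreover have "minor ?M I J = 0 \<longleftrightarrow> (I, J) \<in> vanishing_minors m p C" if "(I, J) \<in> minors m p" for I J
    using same_sign.R_zero_iff[OF sign[OF that]] that by (simp add: vanishing_minors_def)
  ultimately show ?thesis
    unfolding admissible_def by (auto simp: vanishing_minors_def)
qed

lemma vanishing_minors_inj:
  assumes C: "cauchon_diagram m p C" and C': "cauchon_diagram m p C'"
    and eq: "vanishing_minors m p C = vanishing_minors m p C'"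
  shows "C = C'"
proof -
  have rows: "\<forall>a<p. (i, a) \<in> C \<longleftrightarrow> (i, a) \<in> C'" if "i < m" for i
    using that
  proof (induction "m - i" arbitrary: i rule: less_induct)
    case less
    have below: "generic_entry D k c = 0 \<longleftrightarrow> (k, c) \<in> C"
      if "D = C \<or> D = C'" "i < k" "k < m" "c < p" for D k c
      using less.hyps[of k] that less.prems by (auto simp: generic_entry_eq_0_iff)
    show ?case
    proof (intro allI impI)
      fix a assume a: "a < p"
      obtain I J where M: "(I, J) \<in> minors m p" and
        detect: "\<forall>X :: nat \<Rightarrow> nat \<Rightarrow> cpoly fract. cauchon_zeros m p X \<longrightarrow>
          (\<forall>k c. i < k \<longrightarrow> k < m \<longrightarrow> c < p \<longrightarrow> (X k c = 0 \<longleftrightarrow> (k, c) \<in> C)) \<longrightarrow>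
          (minor (restored m p (mat m p (\<lambda>(i, a). X i a))) I J = 0 \<longleftrightarrow> X i a = 0)"
        using entry_detecting_minor[where 'a = "cpoly fract" and Z = "\<lambda>k c. (k, c) \<in> C",
          OF less.prems a] by blast
      have "(I, J) \<in> vanishing_minors m p D \<longleftrightarrow> (i, a) \<in> D" if "D = C \<or> D = C'" for D
      proof -
        have "cauchon_zeros m p (generic_entry D)"
          using that C C' cauchon_generic_entry by blast
        then have "minor (restored m p (generic_matrix m p D)) I J = 0 \<longleftrightarrow> generic_entry D i a = 0"
          unfolding generic_matrix_eq using detect below[OF that] by blast
        then show ?thesis
          using M by (simp add: vanishing_minors_def generic_entry_eq_0_iff)
      qed
      then show "(i, a) \<in> C \<longleftrightarrow> (i, a) \<in> C'"
        using eq by blast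
    qed
  qed
  then show ?thesis
    using C C' unfolding cauchon_diagram_def grid_def by auto
qed

theorem mainTheorem4:
  fixes m p :: nat
  assumes "m \<ge> 2" and "p \<ge> 2"
  shows "(\<forall>C. cauchon_diagram m p C \<longrightarrow> admissible m p (vanishing_minors m p C)) \<and>
    (\<forall>C C'. cauchon_diagram m p C \<longrightarrow> cauchon_diagram m p C' \<longrightarrow> C \<noteq> C' \<longrightarrow>
       vanishing_minors m p C \<noteq> vanishing_minors m p C')"
proof (intro conjI allI impI)
  fix C assume "cauchon_diagram m p C"
  then show "admissible m p (vanishing_minors m p C)"
    using assms by (intro admissible_vanishing_minors) auto
next
  fix C C' assume "cauchon_diagram m p C" "cauchon_diagram m p C'" "C \<noteq> C'"
  then show "vanishing_minors m p C \<noteq> vanishing_minors m p C'"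
    using vanishing_minors_inj by blast
qed

end
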